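(* Let $\alpha<\beta$ be real numbers with $\alpha\beta\neq 0$, and let $$C_{\alpha,\beta}=\sup_{\gamma\in\Gamma_{\alpha,\beta}}\frac{R_{\alpha,\beta}(|x|^\gamma)}{P_{\alpha,\beta}(x^\gamma)} .$$ Then: (i) if $0<\alpha<\beta$, then $$C_{\alpha,\beta}=\begin{cases}2^{\frac1\alpha-\frac1\beta} & \text{if } 0<\alpha\le\frac\beta2,\\ 2^{\frac1\beta} & \text{if } \frac\beta2<\alpha<\beta;\end{cases}$$ (ii) if $\alpha<\beta<0$, then $$C_{\alpha,\beta}=\begin{cases}2^{\frac1\alpha-\frac1\beta} & \text{if } \alpha\le2\beta,\\ 2^{-\frac1\alpha} & \text{if } 2\beta<\alpha<\beta;\end{cases}$$ (iii) if $\alpha<0<\beta$, then $$C_{\alpha,\beta}=\begin{cases}2^{\frac1\beta} & \text{if } 0<\beta\le-\alpha,\\ 2^{-\frac1\alpha} & \text{if } \beta>-\alpha,\end{cases}$$ that is, $C_{\alpha,\beta}=2^{1/\min\{|\alpha|,\beta\}}$.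
   Context: $\mathbb R_+=(0,+\infty)$; all intervals $I$ are bounded and of positive length, and $|I|$ is Lebesgue measure. For $\alpha\neq 0$ and a non-negative function $f$ on $I$, $M_{I,\alpha}(f)=\left(\frac1{|I|}\int_I f^\alpha(x)\,dx\right)^{1/\alpha}$. For $\alpha<\beta$, $\alpha\beta\ne0$: for $f$ on $\mathbb R_+$, $P_{\alpha,\beta}(f)=\sup_{I\subset\mathbb R_+}\frac{M_{I,\beta}(f)}{M_{I,\alpha}(f)}$ over all intervals $I\subset\mathbb R_+$; for $g$ on $\mathbb R$, $R_{\alpha,\beta}(g)=\sup_{I\subset\mathbb R}\frac{M_{I,\beta}(g)}{M_{I,\alpha}(g)}$ over all intervals $I\subset\mathbb R$. Here $x^\gamma$ is considered on $\mathbb R_+$ and $|x|^\gamma$ is its even extension to $\mathbb R$ (the value at $0$ is irrelevant). The admissible set of exponents is $\Gamma_{\alpha,\beta}=\{\gamma\in\mathbb R:\ \alpha\gamma>-1,\ \beta\gamma>-1\}$. *)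

theory Defs
  imports "HOL-Analysis.Analysis"
begin

(* Real powers on [0, \<infinity>], with 0 to a negative power equal to \<infinity> and \<infinity> to a negative
   power equal to 0.  Only exponents a \<noteq> 0 are used below. *)
definition epowr :: "ennreal \<Rightarrow> real \<Rightarrow> ennreal" where
  "epowr x a =
     (if x = 0 then (if a < 0 then \<infinity> else 0)
      else if x = \<infinity> then (if a < 0 then 0 else \<infinity>)
      else ennreal (enn2real x powr a))"

definition bounded_intervals :: "real set set" where
  "bounded_intervals = {I. is_interval I \<and> bounded I \<and> emeasure lborel I > 0}"

(* The mean takes values in [0, \<infinity>], so that a divergent integral yields \<infinity> rather than
   the default value 0 of the Bochner integral. *)
definition power_mean :: "real set \<Rightarrow> real \<Rightarrow> (real \<Rightarrow> real) \<Rightarrow> ennreal" where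
  "power_mean I \<alpha> f =
     epowr ((\<integral>\<^sup>+x\<in>I. epowr (ennreal (f x)) \<alpha> \<partial>lborel) / emeasure lborel I) (1 / \<alpha>)"

definition P_const :: "real \<Rightarrow> real \<Rightarrow> (real \<Rightarrow> real) \<Rightarrow> ennreal" where
  "P_const \<alpha> \<beta> f =
     (SUP I\<in>{I \<in> bounded_intervals. I \<subseteq> {0<..}}. power_mean I \<beta> f / power_mean I \<alpha> f)"

definition R_const :: "real \<Rightarrow> real \<Rightarrow> (real \<Rightarrow> real) \<Rightarrow> ennreal" where
  "R_const \<alpha> \<beta> g =
     (SUP I\<in>bounded_intervals. power_mean I \<beta> g / power_mean I \<alpha> g)"

definition admissible :: "real \<Rightarrow> real \<Rightarrow> real set" where
  "admissible \<alpha> \<beta> = {\<gamma>. \<alpha> * \<gamma> > -1 \<and> \<beta> * \<gamma> > -1}"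

definition C_const :: "real \<Rightarrow> real \<Rightarrow> ennreal" where
  "C_const \<alpha> \<beta> =
     (SUP \<gamma>\<in>admissible \<alpha> \<beta>.
        R_const \<alpha> \<beta> (\<lambda>x. \<bar>x\<bar> powr \<gamma>) / P_const \<alpha> \<beta> (\<lambda>x. x powr \<gamma>))"

end

(* By scaling and reflection it suffices to consider the intervals (t, 1) with -1 <= t < 1.  For
   0 < t < 1 the function x \<mapsto> ln (1 - t powr (1 + \<gamma> x)) is concave, so its chord slopes from 0
   decrease; this says that the ratio of means over (t, 1) is at most that over (0, 1), which is
   therefore P.  For t = -s the ratio exceeds P by the factor

     (1 + s^(1+\<beta>\<gamma>))^(1/\<beta>) (1 + s)^(1/\<alpha>-1/\<beta>) (1 + s^(1+\<alpha>\<gamma>))^(-1/\<alpha>),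

   whose supremum over \<gamma> and s is C.  It is at most 2^(1/\<beta>) if \<gamma> <= 0 < \<beta>, and at most
   2^(1/\<alpha>-1/\<beta>) if 0 < \<alpha> and 0 <= \<gamma>.  These bounds are approached by \<gamma> \<rightarrow> -1/\<beta> followed by
   s \<rightarrow> 0, and by \<gamma> \<rightarrow> \<infinity> followed by s \<rightarrow> 1.  The symmetry (\<alpha>, \<beta>, \<gamma>) \<mapsto> (-\<beta>, -\<alpha>, -\<gamma>), which is
   f \<mapsto> 1/f, gives the remaining signs. *)
theory Submission
  imports Defs "HOL-Real_Asymp.Real_Asymp"
begin

section \<open>Antiderivative and averages of |x|^p\<close>

text \<open>The odd antiderivative sgn(x) |x|^(p+1) / (p+1) of |x|^p. At each x at most one of the
  two powers is nonzero, so one formula serves both half-lines.\<close>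

definition abs_powr_primitive :: "real \<Rightarrow> real \<Rightarrow> real" where
  "abs_powr_primitive p x = (max 0 x powr (p + 1) - max 0 (- x) powr (p + 1)) / (p + 1)"

definition abs_powr_avg :: "real \<Rightarrow> real \<Rightarrow> real \<Rightarrow> real" where
  "abs_powr_avg p a b = (abs_powr_primitive p b - abs_powr_primitive p a) / (b - a)"

definition mean_ratio :: "real \<Rightarrow> real \<Rightarrow> real \<Rightarrow> real \<Rightarrow> real \<Rightarrow> real" where
  "mean_ratio \<alpha> \<beta> \<gamma> a b =
     abs_powr_avg (\<beta> * \<gamma>) a b powr (1 / \<beta>) / abs_powr_avg (\<alpha> * \<gamma>) a b powr (1 / \<alpha>)"

definition excess :: "real \<Rightarrow> real \<Rightarrow> real \<Rightarrow> real \<Rightarrow> real" where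
  "excess \<alpha> \<beta> \<gamma> s =
     (1 + s powr (1 + \<beta> * \<gamma>)) powr (1 / \<beta>) * (1 + s) powr (1 / \<alpha> - 1 / \<beta>)
       * (1 + s powr (1 + \<alpha> * \<gamma>)) powr (- (1 / \<alpha>))"

text \<open>Both powers contribute nondecreasing terms. Strictness comes from the positive part if y
  > 0, and otherwise from the negative part, because then x < 0.\<close>

lemma abs_powr_primitive_strict_mono:
  assumes "p > -1" "x < y"
  shows "abs_powr_primitive p x < abs_powr_primitive p y"
proof -
  have 1: "max 0 x powr (p + 1) \<le> max 0 y powr (p + 1)"
    using assms by (intro powr_mono2) auto
  have 2: "max 0 (-y) powr (p + 1) \<le> max 0 (-x) powr (p + 1)"
    using assms by (intro powr_mono2) auto
  have 3: "max 0 x powr (p + 1) < max 0 y powr (p + 1) \<or>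
           max 0 (-y) powr (p + 1) < max 0 (-x) powr (p + 1)"
  proof (cases "y > 0")
    case True
    then show ?thesis using assms by (intro disjI1 powr_less_mono2) auto
  next
    case False
    then show ?thesis using assms by (intro disjI2 powr_less_mono2) auto
  qed
  have "max 0 x powr (p + 1) - max 0 (-x) powr (p + 1)
      < max 0 y powr (p + 1) - max 0 (-y) powr (p + 1)"
    using 3 1 2 by (elim disjE; linarith)
  then show ?thesis
    unfolding abs_powr_primitive_def using assms by (intro divide_strict_right_mono) simp_all
qed

lemma abs_powr_avg_pos:
  assumes "p > -1" "a < b"
  shows "abs_powr_avg p a b > 0"
  using abs_powr_primitive_strict_mono[OF assms] assms by (simp add: abs_powr_avg_def)

text \<open>For negative p the integrand is unbounded at 0, but p + 1 > 0 keeps the antiderivative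
  continuous there, so the fundamental theorem applies with 0 as exceptional point.\<close>

lemma abs_powr_has_integral:
  assumes "p > -1" "a \<le> b"
  shows "((\<lambda>x. \<bar>x\<bar> powr p) has_integral (abs_powr_primitive p b - abs_powr_primitive p a)) {a..b}"
proof (rule fundamental_theorem_of_calculus_interior_strong[where S = "{0}"])
  show "continuous_on {a..b} (abs_powr_primitive p)"
    unfolding abs_powr_primitive_def[abs_def] using assms
    by (intro continuous_intros continuous_on_powr') auto
next
  fix x assume x: "x \<in> {a<..<b} - {0}"
  consider "x > 0" | "x < 0" using x by fastforce
  then have "(abs_powr_primitive p has_real_derivative \<bar>x\<bar> powr p) (at x)"
  proof cases
    case 1
    have "((\<lambda>x. x powr (p + 1) / (p + 1)) has_real_derivative \<bar>x\<bar> powr p) (at x)"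
      using 1 assms by (auto intro!: derivative_eq_intros)
    then show ?thesis
      by (rule has_field_derivative_transform_within_open[where S = "{0<..}"])
         (use 1 assms in \<open>auto simp: abs_powr_primitive_def\<close>)
  next
    case 2
    have "((\<lambda>x. - ((- x) powr (p + 1) / (p + 1))) has_real_derivative \<bar>x\<bar> powr p) (at x)"
      using 2 assms by (auto intro!: derivative_eq_intros)
    then show ?thesis
      by (rule has_field_derivative_transform_within_open[where S = "{..<0}"])
         (use 2 assms in \<open>auto simp: abs_powr_primitive_def\<close>)
  qed
  then show "(abs_powr_primitive p has_vector_derivative \<bar>x\<bar> powr p) (at x)"
    by (simp add: has_real_derivative_iff_has_vector_derivative)
qed (use assms in auto)

section \<open>Power means over arbitrary bounded intervals as real numbers\<close>

lemma epowr_ennreal: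
  assumes "x > 0"
  shows "epowr (ennreal x) a = ennreal (x powr a)"
  using assms by (simp add: epowr_def)

text \<open>Prescribing f only on the open interval lets one statement serve both |x|^\<gamma> on
  the line and x^\<gamma> on the half-line.\<close>

lemma nn_integral_abs_powr:
  assumes "\<alpha> * \<gamma> > -1" "a < b" "{a<..<b} \<subseteq> I" "I \<subseteq> {a..b}"
    and f: "\<And>x. x \<in> {a<..<b} \<Longrightarrow> f x = \<bar>x\<bar> powr \<gamma>"
  shows "(\<integral>\<^sup>+x\<in>I. epowr (ennreal (f x)) \<alpha> \<partial>lborel)
    = ennreal (abs_powr_primitive (\<alpha> * \<gamma>) b - abs_powr_primitive (\<alpha> * \<gamma>) a)"
proof -
  have "(\<integral>\<^sup>+x\<in>I. epowr (ennreal (f x)) \<alpha> \<partial>lborel)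
      = (\<integral>\<^sup>+x. ennreal (indicator {a..b} x * \<bar>x\<bar> powr (\<alpha> * \<gamma>)) \<partial>lborel)"
  proof (rule nn_integral_cong_AE)
    \<comment> \<open>The endpoints are discarded because I may or may not contain them. At 0 the
      power |x|^\<gamma> takes the value 0, which \<open>epowr\<close> sends to \<infinity> for
      \<alpha> < 0, while the right-hand side is 0.\<close>
    have "AE x in lborel. x \<noteq> 0 \<and> x \<noteq> a \<and> x \<noteq> b"
      by (intro AE_conjI AE_lborel_singleton)
    then show "AE x in lborel. epowr (ennreal (f x)) \<alpha> * indicator I x
        = ennreal (indicator {a..b} x * \<bar>x\<bar> powr (\<alpha> * \<gamma>))"
    proof eventually_elim
      case (elim x)
      show ?case
      proof (cases "x \<in> {a<..<b}")
        case True
        then have "x \<in> I" "x \<in> {a..b}" using assms(3) by auto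
        then show ?thesis
          using f[OF True] elim by (simp add: epowr_ennreal powr_powr mult.commute)
      next
        case False
        then have "x \<notin> {a..b}" using elim by auto
        moreover from this have "x \<notin> I" using assms(4) by auto
        ultimately show ?thesis by simp
      qed
    qed
  qed
  also have "\<dots> = ennreal (abs_powr_primitive (\<alpha> * \<gamma>) b - abs_powr_primitive (\<alpha> * \<gamma>) a)"
    using nn_integral_has_integral_lebesgue[OF _ abs_powr_has_integral[of "\<alpha> * \<gamma>" a b]] assms(1,2)
    by simp
  finally show ?thesis .
qed

text \<open>With a = Inf I and b = Sup I the interval differs from (a, b) in endpoints only, and
  positive measure excludes a single point.\<close>

lemma bounded_intervals_cases:
  assumes "I \<in> bounded_intervals"
  obtains a b where "a < b" "{a<..<b} \<subseteq> I" "I \<subseteq> {a..b}" "emeasure lborel I = ennreal (b - a)"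
proof -
  have I: "is_interval I" "bounded I" "emeasure lborel I > 0"
    using assms by (auto simp: bounded_intervals_def)
  have ne: "I \<noteq> {}" using I(3) by auto
  have bd: "bdd_below I" "bdd_above I"
    using I(2) by (auto simp: bounded_imp_bdd_below bounded_imp_bdd_above)
  define a b where "a = Inf I" and "b = Sup I"
  have sub: "I \<subseteq> {a..b}"
    using bd by (auto simp: a_def b_def intro: cInf_lower cSup_upper)
  have sup: "{a<..<b} \<subseteq> I"
  proof
    fix x assume x: "x \<in> {a<..<b}"
    obtain y where "y \<in> I" "y < x" using x cInf_lessD[OF ne, of x] by (auto simp: a_def)
    moreover obtain z where "z \<in> I" "x < z" using x less_cSupD[OF ne, of x] by (auto simp: b_def)
    ultimately show "x \<in> I" using I(1) by (meson is_interval_1 less_imp_le)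
  qed
  have meas: "I \<in> sets lborel"
    using real_interval_borel_measurable[OF I(1)] by simp
  have ab: "a \<le> b" using ne sub by fastforce
  have "emeasure lborel I \<le> emeasure lborel {a..b}"
    by (rule emeasure_mono[OF sub]) simp
  then have le: "emeasure lborel I \<le> ennreal (b - a)" using ab by simp
  then have "a < b" using I(3) ab by (cases "a = b") auto
  moreover have "emeasure lborel {a<..<b} \<le> emeasure lborel I"
    by (rule emeasure_mono[OF sup meas])
  then have "emeasure lborel I = ennreal (b - a)" using ab le by (intro antisym) auto
  ultimately show ?thesis using that sub sup by blast
qed

lemma power_mean_abs_powr:
  assumes "\<alpha> * \<gamma> > -1" "a < b" "{a<..<b} \<subseteq> I" "I \<subseteq> {a..b}"
    and "emeasure lborel I = ennreal (b - a)"
    and "\<And>x. x \<in> {a<..<b} \<Longrightarrow> f x = \<bar>x\<bar> powr \<gamma>"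
  shows "power_mean I \<alpha> f = ennreal (abs_powr_avg (\<alpha> * \<gamma>) a b powr (1 / \<alpha>))"
  unfolding power_mean_def nn_integral_abs_powr[OF assms(1-4,6), simplified] assms(5)
  using abs_powr_avg_pos[OF assms(1,2)] abs_powr_primitive_strict_mono[OF assms(1,2)] assms(2)
  by (simp add: divide_ennreal epowr_ennreal abs_powr_avg_def)

lemma power_mean_ratio:
  assumes "\<gamma> \<in> admissible \<alpha> \<beta>" "a < b" "{a<..<b} \<subseteq> I" "I \<subseteq> {a..b}"
    and "emeasure lborel I = ennreal (b - a)"
    and "\<And>x. x \<in> {a<..<b} \<Longrightarrow> f x = \<bar>x\<bar> powr \<gamma>"
  shows "power_mean I \<beta> f / power_mean I \<alpha> f = ennreal (mean_ratio \<alpha> \<beta> \<gamma> a b)"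
proof -
  have *: "\<alpha> * \<gamma> > -1" "\<beta> * \<gamma> > -1" using assms(1) by (auto simp: admissible_def)
  show ?thesis
    unfolding power_mean_abs_powr[OF *(1) assms(2-6), simplified]
      power_mean_abs_powr[OF *(2) assms(2-6), simplified] mean_ratio_def
    using abs_powr_avg_pos[OF *(1) assms(2)] by (simp add: divide_ennreal)
qed

lemma Ioo_bounded_intervals:
  assumes "a < b"
  shows "{a<..<b::real} \<in> bounded_intervals"
  using assms by (simp add: bounded_intervals_def is_interval_1)

lemma R_const_abs_powr:
  assumes "\<gamma> \<in> admissible \<alpha> \<beta>"
  shows "R_const \<alpha> \<beta> (\<lambda>x. \<bar>x\<bar> powr \<gamma>)
    = (SUP (a, b)\<in>{(a, b). a < b}. ennreal (mean_ratio \<alpha> \<beta> \<gamma> a b))"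
  unfolding R_const_def
proof (rule antisym; rule SUP_least)
  fix I assume "I \<in> bounded_intervals"
  then obtain a b where *: "a < b" "{a<..<b} \<subseteq> I" "I \<subseteq> {a..b}"
    "emeasure lborel I = ennreal (b - a)" by (rule bounded_intervals_cases)
  show "power_mean I \<beta> (\<lambda>x. \<bar>x\<bar> powr \<gamma>) / power_mean I \<alpha> (\<lambda>x. \<bar>x\<bar> powr \<gamma>)
    \<le> (SUP (a, b)\<in>{(a, b). a < b}. ennreal (mean_ratio \<alpha> \<beta> \<gamma> a b))"
    by (subst power_mean_ratio[OF assms *]) (use * in \<open>auto intro!: SUP_upper2[of "(a, b)"]\<close>)
next
  fix ab :: "real \<times> real" assume "ab \<in> {(a, b). a < b}"
  then obtain a b where *: "ab = (a, b)" "a < b" by auto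
  show "(case ab of (a, b) \<Rightarrow> ennreal (mean_ratio \<alpha> \<beta> \<gamma> a b)) \<le> (SUP I\<in>bounded_intervals.
      power_mean I \<beta> (\<lambda>x. \<bar>x\<bar> powr \<gamma>) / power_mean I \<alpha> (\<lambda>x. \<bar>x\<bar> powr \<gamma>))"
    by (rule SUP_upper2[OF Ioo_bounded_intervals[OF *(2)]])
       (subst power_mean_ratio[OF assms *(2)], use * in auto)
qed

text \<open>The left endpoint a = 0 occurs because (0, b) itself lies in the open half-line. There x
  = |x|, so both constants become suprema of the same \<open>mean_ratio\<close>.\<close>

lemma P_const_powr:
  assumes "\<gamma> \<in> admissible \<alpha> \<beta>"
  shows "P_const \<alpha> \<beta> (\<lambda>x. x powr \<gamma>)
    = (SUP (a, b)\<in>{(a, b). 0 \<le> a \<and> a < b}. ennreal (mean_ratio \<alpha> \<beta> \<gamma> a b))"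
  unfolding P_const_def
proof (rule antisym; rule SUP_least)
  fix I assume I: "I \<in> {I \<in> bounded_intervals. I \<subseteq> {0<..}}"
  then obtain a b where *: "a < b" "{a<..<b} \<subseteq> I" "I \<subseteq> {a..b}"
    "emeasure lborel I = ennreal (b - a)" by (auto elim: bounded_intervals_cases)
  have pos: "x > 0" if "x \<in> {a<..<b}" for x using that * I by auto
  have "a \<ge> 0"
  proof (rule ccontr)
    assume "\<not> 0 \<le> a"
    then obtain x where "a < x" "x < min b 0" using *(1) dense[of a "min b 0"] by auto
    then show False using pos[of x] by auto
  qed
  show "power_mean I \<beta> (\<lambda>x. x powr \<gamma>) / power_mean I \<alpha> (\<lambda>x. x powr \<gamma>)
    \<le> (SUP (a, b)\<in>{(a, b). 0 \<le> a \<and> a < b}. ennreal (mean_ratio \<alpha> \<beta> \<gamma> a b))"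
    by (subst power_mean_ratio[OF assms *])
       (use pos * \<open>a \<ge> 0\<close> in \<open>auto intro!: SUP_upper2[of "(a, b)"] simp: abs_of_pos\<close>)
next
  fix ab :: "real \<times> real" assume "ab \<in> {(a, b). 0 \<le> a \<and> a < b}"
  then obtain a b where *: "ab = (a, b)" "a < b" "0 \<le> a" by auto
  have "{a<..<b} \<in> {I \<in> bounded_intervals. I \<subseteq> {0<..}}"
    using Ioo_bounded_intervals[OF *(2)] * by auto
  then show "(case ab of (a, b) \<Rightarrow> ennreal (mean_ratio \<alpha> \<beta> \<gamma> a b))
    \<le> (SUP I\<in>{I \<in> bounded_intervals. I \<subseteq> {0<..}}.
      power_mean I \<beta> (\<lambda>x. x powr \<gamma>) / power_mean I \<alpha> (\<lambda>x. x powr \<gamma>))"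
    by (rule SUP_upper2)
       (subst power_mean_ratio[OF assms *(2)], use * in auto)
qed

section \<open>Reflection, scaling and reduction to intervals (t, 1)\<close>

lemma abs_powr_avg_uminus: "abs_powr_avg p (- b) (- a) = abs_powr_avg p a b"
proof -
  have "abs_powr_primitive p (- x) = - abs_powr_primitive p x" for x
    by (simp add: abs_powr_primitive_def minus_divide_left)
  then show ?thesis by (simp add: abs_powr_avg_def algebra_simps)
qed

text \<open>The antiderivative is homogeneous of degree p + 1, and division by the length lowers the
  degree to p.\<close>

lemma abs_powr_avg_scale:
  assumes "b > 0"
  shows "abs_powr_avg p a b = b powr p * abs_powr_avg p (a / b) 1"
proof -
  have prim: "abs_powr_primitive p (b * x) = b powr (p + 1) * abs_powr_primitive p x" for x
  proof -
    have "max 0 (b * x) = b * max 0 x" "max 0 (- (b * x)) = b * max 0 (- x)"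
      using assms by (auto simp: max_def zero_le_mult_iff mult_le_0_iff)
    then show ?thesis
      using assms by (simp add: abs_powr_primitive_def powr_mult right_diff_distrib)
  qed
  have "abs_powr_avg p (b * (a / b)) (b * 1) = b powr p * abs_powr_avg p (a / b) 1"
  proof -
    have "b * 1 - b * (a / b) = b * (1 - a / b)" by (simp add: algebra_simps)
    moreover have "b powr (p + 1) = b * b powr p" using assms by (simp add: powr_add)
    ultimately show ?thesis
      unfolding abs_powr_avg_def prim using assms
      by (simp add: right_diff_distrib[symmetric] mult.assoc)
  qed
  then show ?thesis using assms by simp
qed

text \<open>Both means scale by the same factor b^\<gamma>, since
  (b^(\<alpha>\<gamma>))^(1/\<alpha>) = b^\<gamma> and likewise for \<beta>; it cancels in the
  quotient.\<close>

lemma mean_ratio_scale: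
  assumes "\<gamma> \<in> admissible \<alpha> \<beta>" "\<alpha> \<noteq> 0" "\<beta> \<noteq> 0" "a < b" "b > 0"
  shows "mean_ratio \<alpha> \<beta> \<gamma> a b = mean_ratio \<alpha> \<beta> \<gamma> (a / b) 1"
proof -
  have ab: "a / b < 1" using assms by simp
  have "abs_powr_avg (\<alpha> * \<gamma>) (a / b) 1 > 0" "abs_powr_avg (\<beta> * \<gamma>) (a / b) 1 > 0"
    using assms(1) ab by (auto intro!: abs_powr_avg_pos simp: admissible_def)
  then show ?thesis
    unfolding mean_ratio_def abs_powr_avg_scale[OF assms(5)]
    using assms by (simp add: powr_mult powr_powr)
qed

text \<open>After a reflection if necessary, the right endpoint is the one of larger modulus and is
  scaled to 1. The clause on \<open>0 \<le> t\<close> makes the same normalization usable on the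
  half-line.\<close>

lemma mean_ratio_normalize:
  assumes "\<gamma> \<in> admissible \<alpha> \<beta>" "\<alpha> \<noteq> 0" "\<beta> \<noteq> 0" "a < b"
  obtains t where "-1 \<le> t" "t < 1" "0 \<le> a \<Longrightarrow> 0 \<le> t"
    "mean_ratio \<alpha> \<beta> \<gamma> a b = mean_ratio \<alpha> \<beta> \<gamma> t 1"
proof (cases "\<bar>a\<bar> \<le> b")
  case True
  then have "b > 0" using assms by linarith
  show ?thesis
    by (rule that[of "a / b"])
       (use True \<open>b > 0\<close> assms mean_ratio_scale[OF assms \<open>b > 0\<close>] in
         \<open>auto simp: field_simps abs_le_iff\<close>)
next
  case False
  then have a: "a < 0" "-b < -a" "-b \<ge> a" using assms by linarith+
  have "mean_ratio \<alpha> \<beta> \<gamma> a b = mean_ratio \<alpha> \<beta> \<gamma> (- b) (- a)"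
    by (simp add: mean_ratio_def abs_powr_avg_uminus)
  also have "\<dots> = mean_ratio \<alpha> \<beta> \<gamma> ((- b) / (- a)) 1"
    using a assms by (intro mean_ratio_scale) auto
  finally show ?thesis
    by (intro that[of "(- b) / (- a)"]) (use a in \<open>auto simp: field_simps\<close>)
qed

section \<open>Comparison with the interval (0, 1)\<close>

text \<open>The factor \<open>1 / (p + 1)\<close> is the average over (0, 1). It is split off so
  that the other factor measures the change from (0, 1).\<close>

lemma abs_powr_avg_neg_to_1:
  assumes "0 \<le> s" "p > -1"
  shows "abs_powr_avg p (- s) 1 = (1 / (p + 1)) * ((1 + s powr (1 + p)) / (1 + s))"
  using assms by (simp add: abs_powr_avg_def abs_powr_primitive_def add.commute
      add_divide_distrib[symmetric])

lemma abs_powr_avg_pos_to_1: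
  assumes "0 \<le> t" "p > -1"
  shows "abs_powr_avg p t 1 = (1 / (p + 1)) * ((1 - t powr (1 + p)) / (1 - t))"
  using assms by (simp add: abs_powr_avg_def abs_powr_primitive_def add.commute
      diff_divide_distrib[symmetric])

text \<open>Passing from (0, 1) to (-s, 1) multiplies the average of |x|^p by (1 + s^(1+p)) / (1 +
  s). Taking p = \<beta>\<gamma> and p = \<alpha>\<gamma>, the lengths 1 + s combine to the exponent
  1/\<alpha> - 1/\<beta>.\<close>

lemma mean_ratio_neg:
  assumes "\<gamma> \<in> admissible \<alpha> \<beta>" "0 \<le> s"
  shows "mean_ratio \<alpha> \<beta> \<gamma> (- s) 1 = mean_ratio \<alpha> \<beta> \<gamma> 0 1 * excess \<alpha> \<beta> \<gamma> s"
proof -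
  have *: "\<alpha> * \<gamma> > -1" "\<beta> * \<gamma> > -1" using assms(1) by (auto simp: admissible_def)
  have "1 + s powr (1 + \<beta> * \<gamma>) > 0" "1 + s powr (1 + \<alpha> * \<gamma>) > 0"
    by (simp_all add: add_pos_nonneg)
  moreover have "1 + s > 0" using assms by simp
  moreover have avg: "abs_powr_avg p (- s) 1 = abs_powr_avg p 0 1 * ((1 + s powr (1 + p)) / (1 + s))"
    if "p > -1" for p
    using abs_powr_avg_neg_to_1[OF assms(2) that] abs_powr_avg_neg_to_1[OF order.refl that] that
    by simp
  moreover have "abs_powr_avg (\<alpha> * \<gamma>) 0 1 > 0" "abs_powr_avg (\<beta> * \<gamma>) 0 1 > 0"
    using * by (auto intro: abs_powr_avg_pos)
  moreover have "(B * (Y / S)) powr u / (A * (X / S)) powr v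
      = B powr u / A powr v * (Y powr u * S powr (v - u) * X powr (- v))"
    if "A > 0" "B > 0" "X > 0" "Y > 0" "S > 0" for A B X Y S u v :: real
    using that by (simp add: powr_mult powr_divide powr_diff powr_minus divide_simps)
  ultimately show ?thesis
    unfolding mean_ratio_def excess_def avg[OF *(1)] avg[OF *(2)] by blast
qed

text \<open>With u = t^(1+cx), the negated function has second derivative (c ln t)^2 u / (1-u)^2.
  The domain is the half-space (or the whole line) where u < 1, so the logarithm has a positive
  argument.\<close>

lemma concave_on_ln_one_minus_powr:
  fixes c t :: real
  assumes "0 < t" "t < 1"
  shows "concave_on {x. - 1 < c * x} (\<lambda>x. ln (1 - t powr (1 + c * x)))"
  unfolding concave_on_def
proof (rule f''_ge0_imp_convex)
  show "convex {x. - 1 < c * x}"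
    using convex_halfspace_gt[of "-1" c] by simp
next
  fix x assume "x \<in> {x. - 1 < c * x}"
  then have x: "t powr (1 + c * x) < 1"
    using assms powr_less_mono'[of t 0 "1 + c * x"] by simp
  show "((\<lambda>x. - ln (1 - t powr (1 + c * x))) has_real_derivative
      c * ln t * t powr (1 + c * x) / (1 - t powr (1 + c * x))) (at x)"
    using x assms by (auto intro!: derivative_eq_intros simp: divide_simps)
  have "((\<lambda>x. t powr (1 + c * x)) has_real_derivative c * ln t * t powr (1 + c * x)) (at x)"
    using assms by (auto intro!: derivative_eq_intros)
  then show "((\<lambda>x. c * ln t * t powr (1 + c * x) / (1 - t powr (1 + c * x))) has_real_derivative
      (c * ln t)\<^sup>2 * t powr (1 + c * x) / (1 - t powr (1 + c * x))\<^sup>2) (at x)"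
    using x by (auto intro!: derivative_eq_intros simp: power2_eq_square algebra_simps divide_simps)
  show "(c * ln t)\<^sup>2 * t powr (1 + c * x) / (1 - t powr (1 + c * x))\<^sup>2 \<ge> 0"
    by simp
qed

text \<open>Concavity is applied to whichever of \<alpha>, \<beta>, 0 lies between the other
  two.\<close>

lemma concave_on_slope_from_0:
  fixes h :: "real \<Rightarrow> real"
  assumes "concave_on S h" "\<alpha> \<in> S" "\<beta> \<in> S" "0 \<in> S" "\<alpha> < \<beta>" "\<alpha> \<noteq> 0" "\<beta> \<noteq> 0"
  shows "(h \<beta> - h 0) / \<beta> \<le> (h \<alpha> - h 0) / \<alpha>"
proof -
  consider "0 < \<alpha>" | "\<beta> < 0" | "\<alpha> < 0" "0 < \<beta>" using assms by linarith
  then show ?thesis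
  proof cases
    case 1
    then have "h \<alpha> \<ge> (1 - \<alpha> / \<beta>) * h 0 + \<alpha> / \<beta> * h \<beta>"
      using concave_onD[OF assms(1), of "\<alpha> / \<beta>" 0 \<beta>] assms by simp
    with 1 assms show ?thesis by (simp add: field_simps)
  next
    case 2
    then have "0 \<le> \<beta> / \<alpha>" "\<beta> / \<alpha> \<le> 1"
      using assms by (auto simp: divide_nonpos_nonpos divide_le_eq)
    then have "h \<beta> \<ge> (1 - \<beta> / \<alpha>) * h 0 + \<beta> / \<alpha> * h \<alpha>"
      using concave_onD[OF assms(1), of "\<beta> / \<alpha>" 0 \<alpha>] assms by simp
    with 2 assms show ?thesis by (simp add: field_simps)
  next
    case 3
    define u where "u = - \<alpha> / (\<beta> - \<alpha>)"
    have u: "0 \<le> u" "u \<le> 1" "(1 - u) * \<alpha> + u * \<beta> = 0"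
      using 3 by (auto simp: u_def field_simps)
    then have "h 0 \<ge> (1 - u) * h \<alpha> + u * h \<beta>"
      using concave_onD[OF assms(1) u(1,2) assms(2,3)] by simp
    moreover have "(1 - u) * h \<alpha> + u * h \<beta> = (\<beta> * h \<alpha> - \<alpha> * h \<beta>) / (\<beta> - \<alpha>)"
    proof -
      have "1 - u = \<beta> / (\<beta> - \<alpha>)" using 3 by (simp add: u_def field_simps)
      then show ?thesis by (simp add: u_def diff_divide_distrib)
    qed
    ultimately have "\<beta> * h \<alpha> - \<alpha> * h \<beta> \<le> h 0 * (\<beta> - \<alpha>)"
      using 3 by (simp add: pos_divide_le_eq)
    with 3 show ?thesis by (simp add: field_simps)
  qed
qed

lemma mean_ratio_pos:
  assumes "\<gamma> \<in> admissible \<alpha> \<beta>" "a < b"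
  shows "mean_ratio \<alpha> \<beta> \<gamma> a b > 0"
  using assms abs_powr_avg_pos[of "\<alpha> * \<gamma>" a b] abs_powr_avg_pos[of "\<beta> * \<gamma>" a b]
  by (auto simp: mean_ratio_def admissible_def)

lemma mean_ratio_le:
  assumes "\<gamma> \<in> admissible \<alpha> \<beta>" "\<alpha> < \<beta>" "\<alpha> \<noteq> 0" "\<beta> \<noteq> 0" "0 \<le> t" "t < 1"
  shows "mean_ratio \<alpha> \<beta> \<gamma> t 1 \<le> mean_ratio \<alpha> \<beta> \<gamma> 0 1"
proof (cases "t = 0")
  case False
  with assms have t: "0 < t" "t < 1" by auto
  have *: "- 1 < \<alpha> * \<gamma>" "- 1 < \<beta> * \<gamma>" using assms(1) by (auto simp: admissible_def)
  define h where "h = (\<lambda>x. ln (1 - t powr (1 + \<gamma> * x)))"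
  have lt1: "t powr (1 + \<alpha> * \<gamma>) < 1" "t powr (1 + \<beta> * \<gamma>) < 1"
    using t * powr_less_mono'[of t 0 "1 + \<alpha> * \<gamma>"] powr_less_mono'[of t 0 "1 + \<beta> * \<gamma>"] by auto
  have slope: "(h \<beta> - h 0) / \<beta> \<le> (h \<alpha> - h 0) / \<alpha>"
    by (rule concave_on_slope_from_0[OF concave_on_ln_one_minus_powr[OF t, of \<gamma>, folded h_def]])
       (use * assms in \<open>auto simp: mult.commute\<close>)
  \<comment> \<open>Since \<open>h 0\<close> is \<open>ln (1 - t)\<close>, the difference
    \<open>h x - h 0\<close> accounts for both the integral over (t, 1) and the length of that
    interval.\<close>
  have ln_avg: "ln (abs_powr_avg (x * \<gamma>) t 1) = ln (abs_powr_avg (x * \<gamma>) 0 1) + (h x - h 0)"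
    if "- 1 < x * \<gamma>" "t powr (1 + x * \<gamma>) < 1" for x
    using that t by (simp add: abs_powr_avg_pos_to_1 h_def ln_mult ln_div mult.commute)
  have ln_ratio: "ln (mean_ratio \<alpha> \<beta> \<gamma> r 1)
      = ln (abs_powr_avg (\<beta> * \<gamma>) r 1) / \<beta> - ln (abs_powr_avg (\<alpha> * \<gamma>) r 1) / \<alpha>" if "r < 1" for r
    using abs_powr_avg_pos[OF *(1) that] abs_powr_avg_pos[OF *(2) that]
    by (simp add: mean_ratio_def ln_div)
  have "ln (mean_ratio \<alpha> \<beta> \<gamma> t 1) \<le> ln (mean_ratio \<alpha> \<beta> \<gamma> 0 1)"
    using slope t by (simp add: ln_ratio ln_avg[OF *(1) lt1(1)] ln_avg[OF *(2) lt1(2)] add_divide_distrib)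
  then show ?thesis using mean_ratio_pos[OF assms(1)] t by simp
qed simp

lemma P_const_powr_eq:
  assumes "\<gamma> \<in> admissible \<alpha> \<beta>" "\<alpha> < \<beta>" "\<alpha> \<noteq> 0" "\<beta> \<noteq> 0"
  shows "P_const \<alpha> \<beta> (\<lambda>x. x powr \<gamma>) = ennreal (mean_ratio \<alpha> \<beta> \<gamma> 0 1)"
  unfolding P_const_powr[OF assms(1)]
proof (rule antisym)
  have "mean_ratio \<alpha> \<beta> \<gamma> a b \<le> mean_ratio \<alpha> \<beta> \<gamma> 0 1" if ab: "0 \<le> a" "a < b" for a b
  proof -
    obtain t where "0 \<le> t" "t < 1" "mean_ratio \<alpha> \<beta> \<gamma> a b = mean_ratio \<alpha> \<beta> \<gamma> t 1"
      using mean_ratio_normalize[OF assms(1,3,4) ab(2)] ab(1) by metis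
    then show ?thesis using mean_ratio_le[OF assms] by simp
  qed
  then show "(SUP (a, b)\<in>{(a, b). 0 \<le> a \<and> a < b}. ennreal (mean_ratio \<alpha> \<beta> \<gamma> a b))
      \<le> ennreal (mean_ratio \<alpha> \<beta> \<gamma> 0 1)"
    by (auto intro!: SUP_least ennreal_leI)
qed (auto intro!: SUP_upper2[of "(0, 1)"])

section \<open>The constant C as a supremum of the excess\<close>

lemma excess_0 [simp]: "excess \<alpha> \<beta> \<gamma> 0 = 1"
  by (simp add: excess_def)

text \<open>The number K is both the value of P and the common factor of all ratios in R. As 0 < K <
  \<infinity>, it cancels in the quotient.\<close>

lemma C_const_eq_SUP_excess:
  assumes "\<alpha> < \<beta>" "\<alpha> \<noteq> 0" "\<beta> \<noteq> 0"
  shows "C_const \<alpha> \<beta> = (SUP \<gamma>\<in>admissible \<alpha> \<beta>. SUP s\<in>{0..1}. ennreal (excess \<alpha> \<beta> \<gamma> s))"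
  unfolding C_const_def
proof (rule SUP_cong[OF refl])
  fix \<gamma> assume \<gamma>: "\<gamma> \<in> admissible \<alpha> \<beta>"
  define K where "K = mean_ratio \<alpha> \<beta> \<gamma> 0 1"
  have K: "K > 0" unfolding K_def by (rule mean_ratio_pos[OF \<gamma>]) simp
  define E where "E = (SUP s\<in>{0..1}. ennreal (excess \<alpha> \<beta> \<gamma> s))"
  have "R_const \<alpha> \<beta> (\<lambda>x. \<bar>x\<bar> powr \<gamma>) = ennreal K * E"
    unfolding R_const_abs_powr[OF \<gamma>]
  proof (rule antisym)
    have "ennreal (mean_ratio \<alpha> \<beta> \<gamma> a b) \<le> ennreal K * E" if ab: "a < b" for a b
    proof -
      obtain t where t: "- 1 \<le> t" "t < 1" "mean_ratio \<alpha> \<beta> \<gamma> a b = mean_ratio \<alpha> \<beta> \<gamma> t 1"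
        using mean_ratio_normalize[OF \<gamma> assms(2,3) ab] by metis
      \<comment> \<open>Intervals with t \<ge> 0 are dominated by (0, 1), which is s = 0 with excess
        1; for t < 0 the choice s = -t gives equality.\<close>
      obtain s where s: "s \<in> {0..1}" "mean_ratio \<alpha> \<beta> \<gamma> t 1 \<le> K * excess \<alpha> \<beta> \<gamma> s"
      proof (cases "0 \<le> t")
        case True
        then show ?thesis using that[of 0] mean_ratio_le[OF \<gamma> assms] t by (simp add: K_def)
      next
        case False
        then show ?thesis using that[of "- t"] mean_ratio_neg[OF \<gamma>, of "- t"] t by (simp add: K_def)
      qed
      have "ennreal (mean_ratio \<alpha> \<beta> \<gamma> a b) \<le> ennreal K * ennreal (excess \<alpha> \<beta> \<gamma> s)"
        using s(2) t(3) K by (simp add: ennreal_mult'[symmetric] ennreal_leI)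
      also have "\<dots> \<le> ennreal K * E"
        unfolding E_def using s(1) by (intro mult_left_mono SUP_upper) auto
      finally show ?thesis .
    qed
    then show "(SUP (a, b)\<in>{(a, b). a < b}. ennreal (mean_ratio \<alpha> \<beta> \<gamma> a b)) \<le> ennreal K * E"
      by (auto intro!: SUP_least)
    show "ennreal K * E \<le> (SUP (a, b)\<in>{(a, b). a < b}. ennreal (mean_ratio \<alpha> \<beta> \<gamma> a b))"
      unfolding E_def SUP_mult_left_ennreal
    proof (rule SUP_least)
      fix s :: real assume "s \<in> {0..1}"
      then show "ennreal K * ennreal (excess \<alpha> \<beta> \<gamma> s)
          \<le> (SUP (a, b)\<in>{(a, b). a < b}. ennreal (mean_ratio \<alpha> \<beta> \<gamma> a b))"
        using K mean_ratio_neg[OF \<gamma>, of s]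
        by (intro SUP_upper2[of "(- s, 1)"]) (auto simp: ennreal_mult'[symmetric] K_def)
    qed
  qed
  moreover have "P_const \<alpha> \<beta> (\<lambda>x. x powr \<gamma>) = ennreal K"
    unfolding K_def by (rule P_const_powr_eq[OF \<gamma> assms])
  ultimately show "R_const \<alpha> \<beta> (\<lambda>x. \<bar>x\<bar> powr \<gamma>) / P_const \<alpha> \<beta> (\<lambda>x. x powr \<gamma>) = E"
    using K by (simp add: mult.commute[of "ennreal K"] ennreal_mult_divide_eq)
qed

text \<open>The substitution exchanges the first and last factors and fixes the exponent of 1 +
  s.\<close>

lemma excess_dual: "excess (- \<beta>) (- \<alpha>) (- \<gamma>) s = excess \<alpha> \<beta> \<gamma> s"
  by (simp add: excess_def)

text \<open>The map \<gamma> \<mapsto> -\<gamma> carries one admissible set onto the other, and the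
  excess agrees at corresponding points.\<close>

lemma C_const_dual:
  assumes "\<alpha> < \<beta>" "\<alpha> \<noteq> 0" "\<beta> \<noteq> 0"
  shows "C_const (- \<beta>) (- \<alpha>) = C_const \<alpha> \<beta>"
proof -
  have *: "admissible (- \<beta>) (- \<alpha>) = uminus ` admissible \<alpha> \<beta>"
  proof (intro set_eqI iffI)
    fix x assume "x \<in> admissible (- \<beta>) (- \<alpha>)"
    then show "x \<in> uminus ` admissible \<alpha> \<beta>"
      by (intro image_eqI[of _ _ "- x"]) (auto simp: admissible_def)
  qed (auto simp: admissible_def)
  show ?thesis
    using assms by (simp add: C_const_eq_SUP_excess * image_image excess_dual)
qed

lemma excess_le_C_const:
  assumes "\<alpha> < \<beta>" "\<alpha> \<noteq> 0" "\<beta> \<noteq> 0" "\<gamma> \<in> admissible \<alpha> \<beta>" "0 \<le> s" "s \<le> 1"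
  shows "ennreal (excess \<alpha> \<beta> \<gamma> s) \<le> C_const \<alpha> \<beta>"
  unfolding C_const_eq_SUP_excess[OF assms(1-3)]
  by (rule SUP_upper2[OF assms(4)], rule SUP_upper) (use assms in auto)

section \<open>Upper bounds for the excess\<close>

text \<open>The first factor is at most 2^(1/\<beta>). In the last one s^(1+\<alpha>\<gamma>) may be
  replaced by s, after which the powers of 1 + s collapse to (1+s)^(-1/\<beta>) \<le> 1.\<close>

lemma excess_le_nonpos:
  assumes "\<alpha> < \<beta>" "\<alpha> \<noteq> 0" "0 < \<beta>" "\<gamma> \<in> admissible \<alpha> \<beta>" "\<gamma> \<le> 0" "0 \<le> s" "s \<le> 1"
  shows "excess \<alpha> \<beta> \<gamma> s \<le> 2 powr (1 / \<beta>)"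
proof -
  have adm: "1 + \<alpha> * \<gamma> > 0" "1 + \<beta> * \<gamma> > 0" using assms by (auto simp: admissible_def)
  have 1: "(1 + s powr (1 + \<beta> * \<gamma>)) powr (1 / \<beta>) \<le> 2 powr (1 / \<beta>)"
    using assms adm powr_mono2[of "1 + \<beta> * \<gamma>" s 1] by (intro powr_mono2) auto
  \<comment> \<open>The sign of \<alpha> decides both the comparison of s^(1+\<alpha>\<gamma>) with
    s and the monotonicity of the outer power, so the two reversals cancel.\<close>
  have 2: "(1 + s powr (1 + \<alpha> * \<gamma>)) powr (- (1 / \<alpha>)) \<le> (1 + s) powr (- (1 / \<alpha>))"
  proof (cases "0 < \<alpha>")
    case True
    then have "s powr 1 \<le> s powr (1 + \<alpha> * \<gamma>)"
      using assms by (intro powr_mono') (auto simp: mult_le_0_iff)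
    with True assms show ?thesis by (intro powr_mono2') auto
  next
    case False
    then have "s powr (1 + \<alpha> * \<gamma>) \<le> s powr 1"
      using assms by (intro powr_mono') (auto simp: zero_le_mult_iff)
    with False assms show ?thesis by (intro powr_mono2) auto
  qed
  have "excess \<alpha> \<beta> \<gamma> s \<le>
      2 powr (1 / \<beta>) * (1 + s) powr (1 / \<alpha> - 1 / \<beta>) * (1 + s) powr (- (1 / \<alpha>))"
    unfolding excess_def by (intro mult_mono 1 2) auto
  also have "\<dots> = 2 powr (1 / \<beta>) * (1 + s) powr (- (1 / \<beta>))"
    by (simp add: powr_add[symmetric] mult.assoc)
  also have "\<dots> \<le> 2 powr (1 / \<beta>) * (1 + s) powr 0"
    using assms by (intro mult_left_mono powr_mono) auto
  finally show ?thesis using assms by simp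
qed

text \<open>Let A = 1 + s^(1+\<alpha>\<gamma>). The first factor is at most A^(1/\<beta>), hence at
  most A^(1/\<alpha>) because A \<ge> 1, and this cancels the last factor.\<close>

lemma excess_le_nonneg:
  assumes "0 < \<alpha>" "\<alpha> < \<beta>" "0 \<le> \<gamma>" "0 \<le> s" "s \<le> 1"
  shows "excess \<alpha> \<beta> \<gamma> s \<le> 2 powr (1 / \<alpha> - 1 / \<beta>)"
proof -
  let ?A = "1 + s powr (1 + \<alpha> * \<gamma>)"
  have inv: "1 / \<beta> < 1 / \<alpha>" using assms by (simp add: frac_less2)
  have "s powr (1 + \<beta> * \<gamma>) \<le> s powr (1 + \<alpha> * \<gamma>)"
    using assms by (intro powr_mono') (auto intro: mult_right_mono)
  then have "(1 + s powr (1 + \<beta> * \<gamma>)) powr (1 / \<beta>) \<le> ?A powr (1 / \<beta>)"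
    using assms by (intro powr_mono2) auto
  also have "\<dots> \<le> ?A powr (1 / \<alpha>)"
    using inv by (intro powr_mono) auto
  finally have 1: "(1 + s powr (1 + \<beta> * \<gamma>)) powr (1 / \<beta>) \<le> ?A powr (1 / \<alpha>)" .
  have 2: "(1 + s) powr (1 / \<alpha> - 1 / \<beta>) \<le> 2 powr (1 / \<alpha> - 1 / \<beta>)"
    using inv assms by (intro powr_mono2) auto
  have "excess \<alpha> \<beta> \<gamma> s \<le>
      ?A powr (1 / \<alpha>) * 2 powr (1 / \<alpha> - 1 / \<beta>) * ?A powr (- (1 / \<alpha>))"
    unfolding excess_def by (intro mult_mono 1 2) auto
  also have "\<dots> = 2 powr (1 / \<alpha> - 1 / \<beta>) * ?A powr (1 / \<alpha> + - (1 / \<alpha>))"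
    unfolding powr_add by simp
  also have "?A \<noteq> 0" using powr_ge_zero[of s "1 + \<alpha> * \<gamma>"] by linarith
  then have "2 powr (1 / \<alpha> - 1 / \<beta>) * ?A powr (1 / \<alpha> + - (1 / \<alpha>)) = 2 powr (1 / \<alpha> - 1 / \<beta>)"
    by simp
  finally show ?thesis .
qed

lemma C_const_le:
  assumes "\<alpha> < \<beta>" "\<alpha> \<noteq> 0" "\<beta> \<noteq> 0"
    and "\<And>\<gamma> s. \<gamma> \<in> admissible \<alpha> \<beta> \<Longrightarrow> 0 \<le> s \<Longrightarrow> s \<le> 1 \<Longrightarrow> excess \<alpha> \<beta> \<gamma> s \<le> M"
  shows "C_const \<alpha> \<beta> \<le> ennreal M"
  unfolding C_const_eq_SUP_excess[OF assms(1-3)]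
  using assms(4) by (auto intro!: SUP_least ennreal_leI)

section \<open>Lower bounds by iterated limits\<close>

lemma C_const_ge_pos:
  assumes "\<alpha> < \<beta>" "\<alpha> \<noteq> 0" "0 < \<beta>"
  shows "C_const \<alpha> \<beta> \<ge> ennreal (2 powr (1 / \<beta>))"
proof -
  \<comment> \<open>This is the excess at the inadmissible boundary exponent \<gamma> = -1/\<beta>,
    where s^(1+\<beta>\<gamma>) equals 1 for every s > 0, however small.\<close>
  define g where "g s = 2 powr (1 / \<beta>) * (1 + s) powr (1 / \<alpha> - 1 / \<beta>)
       * (1 + s powr (1 - \<alpha> / \<beta>)) powr (- (1 / \<alpha>))" for s :: real
  have \<alpha>\<beta>: "1 - \<alpha> / \<beta> > 0" using assms by simp
  have g_le: "ennreal (g s) \<le> C_const \<alpha> \<beta>" if s: "0 < s" "s < 1" for s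
  proof (rule tendsto_upperbound)
    have "((\<lambda>\<gamma>. excess \<alpha> \<beta> \<gamma> s) \<longlongrightarrow> (1 + s powr (1 + \<beta> * (- 1 / \<beta>))) powr (1 / \<beta>)
        * (1 + s) powr (1 / \<alpha> - 1 / \<beta>)
        * (1 + s powr (1 + \<alpha> * (- 1 / \<beta>))) powr (- (1 / \<alpha>))) (at_right (- 1 / \<beta>))"
      unfolding excess_def using s assms
      by (intro tendsto_intros) (auto simp: add_nonneg_eq_0_iff)
    then have "((\<lambda>\<gamma>. excess \<alpha> \<beta> \<gamma> s) \<longlongrightarrow> g s) (at_right (- 1 / \<beta>))"
      using s assms by (simp add: g_def)
    then show "((\<lambda>\<gamma>. ennreal (excess \<alpha> \<beta> \<gamma> s)) \<longlongrightarrow> ennreal (g s)) (at_right (- 1 / \<beta>))"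
      by (rule tendsto_ennrealI)
    \<comment> \<open>Approaching -1/\<beta> from the right secures \<beta>\<gamma> > -1. The other
      condition holds near the limit because -\<alpha>/\<beta> > -1.\<close>
    have "((\<lambda>\<gamma>. \<alpha> * \<gamma>) \<longlongrightarrow> \<alpha> * (- 1 / \<beta>)) (at_right (- 1 / \<beta>))"
      by (intro tendsto_intros)
    then have "\<forall>\<^sub>F \<gamma> in at_right (- 1 / \<beta>). \<alpha> * \<gamma> > - 1"
      by (rule order_tendstoD) (use \<alpha>\<beta> in auto)
    moreover have "\<forall>\<^sub>F \<gamma> in at_right (- 1 / \<beta>). \<gamma> > - 1 / \<beta>"
      by (rule eventually_at_right_less)
    ultimately show "\<forall>\<^sub>F \<gamma> in at_right (- 1 / \<beta>). ennreal (excess \<alpha> \<beta> \<gamma> s) \<le> C_const \<alpha> \<beta>"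
    proof eventually_elim
      case (elim \<gamma>)
      then show ?case
        using assms s
        by (intro excess_le_C_const) (auto simp: admissible_def field_simps)
    qed
  qed simp
  show ?thesis
  proof (rule tendsto_upperbound)
    \<comment> \<open>The positive exponent 1 - \<alpha>/\<beta> makes the last factor of g tend to
      1, so only 2^(1/\<beta>) survives as s \<rightarrow> 0.\<close>
    have "((\<lambda>s. s powr (1 - \<alpha> / \<beta>)) \<longlongrightarrow> 0) (at_right 0)"
      using \<alpha>\<beta> by real_asymp
    then have "(g \<longlongrightarrow> 2 powr (1 / \<beta>) * (1 + 0) powr (1 / \<alpha> - 1 / \<beta>)
        * (1 + 0) powr (- (1 / \<alpha>))) (at_right 0)"
      unfolding g_def[abs_def] by (intro tendsto_intros) auto
    then show "((\<lambda>s. ennreal (g s)) \<longlongrightarrow> ennreal (2 powr (1 / \<beta>))) (at_right 0)"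
      by (intro tendsto_ennrealI) simp
    have "\<forall>\<^sub>F s in at_right 0. s \<in> {0<..<1::real}"
      by (rule eventually_at_right_real) simp
    then show "\<forall>\<^sub>F s in at_right 0. ennreal (g s) \<le> C_const \<alpha> \<beta>"
      by eventually_elim (use g_le in auto)
  qed simp
qed

text \<open>With both exponents positive every \<gamma> \<ge> 0 is admissible. For fixed s < 1 both
  powers of s vanish as \<gamma> \<rightarrow> \<infinity>, which leaves only the power of 1 +
  s.\<close>

lemma C_const_ge_both_pos:
  assumes "0 < \<alpha>" "\<alpha> < \<beta>"
  shows "C_const \<alpha> \<beta> \<ge> ennreal (2 powr (1 / \<alpha> - 1 / \<beta>))"
proof -
  have le: "ennreal ((1 + s) powr (1 / \<alpha> - 1 / \<beta>)) \<le> C_const \<alpha> \<beta>" if s: "0 < s" "s < 1" for s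
  proof (rule tendsto_upperbound)
    have lim: "((\<lambda>\<gamma>. s powr (1 + x * \<gamma>)) \<longlongrightarrow> 0) at_top" if "x > 0" for x
    proof -
      have "((\<lambda>\<gamma>. exp (c + k * \<gamma>)) \<longlongrightarrow> 0) at_top" if "k < 0" for c k :: real
        using that by real_asymp
      from this[of "x * ln s" "ln s"] show ?thesis
        using s that by (simp add: powr_def mult_pos_neg algebra_simps)
    qed
    have "((\<lambda>\<gamma>. excess \<alpha> \<beta> \<gamma> s) \<longlongrightarrow> (1 + 0) powr (1 / \<beta>)
        * (1 + s) powr (1 / \<alpha> - 1 / \<beta>) * (1 + 0) powr (- (1 / \<alpha>))) at_top"
      unfolding excess_def using s assms
      by (intro tendsto_intros lim) auto
    then show "((\<lambda>\<gamma>. ennreal (excess \<alpha> \<beta> \<gamma> s)) \<longlongrightarrow>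
        ennreal ((1 + s) powr (1 / \<alpha> - 1 / \<beta>))) at_top"
      by (intro tendsto_ennrealI) simp
    show "\<forall>\<^sub>F \<gamma> in at_top. ennreal (excess \<alpha> \<beta> \<gamma> s) \<le> C_const \<alpha> \<beta>"
      using eventually_ge_at_top[of "0::real"]
    proof eventually_elim
      case (elim \<gamma>)
      then have "0 \<le> \<alpha> * \<gamma>" "0 \<le> \<beta> * \<gamma>" using assms by auto
      then show ?case
        using assms s by (intro excess_le_C_const) (auto simp: admissible_def)
    qed
  qed simp
  show ?thesis
  proof (rule tendsto_upperbound)
    have "((\<lambda>s. (1 + s) powr (1 / \<alpha> - 1 / \<beta>)) \<longlongrightarrow> (1 + 1) powr (1 / \<alpha> - 1 / \<beta>)) (at_left 1)"
      by (intro tendsto_intros) auto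
    then show "((\<lambda>s. ennreal ((1 + s) powr (1 / \<alpha> - 1 / \<beta>))) \<longlongrightarrow>
        ennreal (2 powr (1 / \<alpha> - 1 / \<beta>))) (at_left 1)"
      by (intro tendsto_ennrealI) simp
    have "\<forall>\<^sub>F s in at_left 1. s \<in> {0<..<1::real}"
      by (rule eventually_at_left_real) simp
    then show "\<forall>\<^sub>F s in at_left 1. ennreal ((1 + s) powr (1 / \<alpha> - 1 / \<beta>)) \<le> C_const \<alpha> \<beta>"
      by eventually_elim (use le in auto)
  qed simp
qed

section \<open>Evaluation of C\<close>

lemma C_const_both_pos:
  assumes "0 < \<alpha>" "\<alpha> < \<beta>"
  shows "C_const \<alpha> \<beta> = ennreal (max (2 powr (1 / \<beta>)) (2 powr (1 / \<alpha> - 1 / \<beta>)))"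
proof (rule antisym)
  show "C_const \<alpha> \<beta> \<le> ennreal (max (2 powr (1 / \<beta>)) (2 powr (1 / \<alpha> - 1 / \<beta>)))"
  proof (rule C_const_le)
    fix \<gamma> s :: real assume *: "\<gamma> \<in> admissible \<alpha> \<beta>" "0 \<le> s" "s \<le> 1"
    show "excess \<alpha> \<beta> \<gamma> s \<le> max (2 powr (1 / \<beta>)) (2 powr (1 / \<alpha> - 1 / \<beta>))"
    proof (cases "0 \<le> \<gamma>")
      case True
      then show ?thesis using excess_le_nonneg[OF assms True *(2,3)] by simp
    next
      case False
      then show ?thesis using excess_le_nonpos[OF assms(2) _ _ *(1) _ *(2,3)] assms by simp
    qed
  qed (use assms in auto)
  show "ennreal (max (2 powr (1 / \<beta>)) (2 powr (1 / \<alpha> - 1 / \<beta>))) \<le> C_const \<alpha> \<beta>"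
    using C_const_ge_pos[OF assms(2)] C_const_ge_both_pos[OF assms] assms by (simp add: max_def)
qed

text \<open>The bound for nonpositive exponents covers both signs of \<gamma>: for \<gamma> \<ge> 0
  it is applied to the dual triple (-\<beta>, -\<alpha>, -\<gamma>), where it reads
  2^(-1/\<alpha>).\<close>

lemma C_const_mixed:
  assumes "\<alpha> < 0" "0 < \<beta>"
  shows "C_const \<alpha> \<beta> = ennreal (max (2 powr (1 / \<beta>)) (2 powr (- (1 / \<alpha>))))"
proof (rule antisym)
  show "C_const \<alpha> \<beta> \<le> ennreal (max (2 powr (1 / \<beta>)) (2 powr (- (1 / \<alpha>))))"
  proof (rule C_const_le)
    fix \<gamma> s :: real assume *: "\<gamma> \<in> admissible \<alpha> \<beta>" "0 \<le> s" "s \<le> 1"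
    show "excess \<alpha> \<beta> \<gamma> s \<le> max (2 powr (1 / \<beta>)) (2 powr (- (1 / \<alpha>)))"
    proof (cases "0 \<le> \<gamma>")
      case True
      have "- \<gamma> \<in> admissible (- \<beta>) (- \<alpha>)" using * by (simp add: admissible_def)
      then show ?thesis
        using excess_le_nonpos[of "- \<beta>" "- \<alpha>" "- \<gamma>" s] True * assms by (simp add: excess_dual)
    next
      case False
      then show ?thesis using excess_le_nonpos[OF _ _ _ *(1) _ *(2,3)] assms by simp
    qed
  qed (use assms in auto)
  have "ennreal (2 powr (- (1 / \<alpha>))) \<le> C_const \<alpha> \<beta>"
    using C_const_ge_pos[of "- \<beta>" "- \<alpha>"] C_const_dual[of \<alpha> \<beta>] assms by simp
  then show "ennreal (max (2 powr (1 / \<beta>)) (2 powr (- (1 / \<alpha>)))) \<le> C_const \<alpha> \<beta>"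
    using C_const_ge_pos[of \<alpha> \<beta>] assms by (simp add: max_def)
qed

theorem mainTheorem2:
  fixes \<alpha> \<beta> :: real
  assumes "\<alpha> < \<beta>" and "\<alpha> * \<beta> \<noteq> 0"
  shows
    "(0 < \<alpha> \<longrightarrow>
        C_const \<alpha> \<beta> = ennreal (if \<alpha> \<le> \<beta> / 2 then 2 powr (1 / \<alpha> - 1 / \<beta>) else 2 powr (1 / \<beta>)))
     \<and> (\<beta> < 0 \<longrightarrow>
        C_const \<alpha> \<beta> = ennreal (if \<alpha> \<le> 2 * \<beta> then 2 powr (1 / \<alpha> - 1 / \<beta>) else 2 powr (- (1 / \<alpha>))))
     \<and> (\<alpha> < 0 \<and> 0 < \<beta> \<longrightarrow>
        C_const \<alpha> \<beta> = ennreal (if \<beta> \<le> - \<alpha> then 2 powr (1 / \<beta>) else 2 powr (- (1 / \<alpha>)))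
        \<and> C_const \<alpha> \<beta> = ennreal (2 powr (1 / min \<bar>\<alpha>\<bar> \<beta>)))"
proof (intro conjI impI)
  have pos: "C_const a b = ennreal (if a \<le> b / 2 then 2 powr (1 / a - 1 / b) else 2 powr (1 / b))"
    if "0 < a" "a < b" for a b :: real
  proof -
    \<comment> \<open>The case boundary a = b/2 is where the two candidates of the maximum
      coincide.\<close>
    have "1 / b \<le> 1 / a - 1 / b \<longleftrightarrow> a \<le> b / 2" using that by (simp add: field_simps)
    then show ?thesis unfolding C_const_both_pos[OF that] max_def by simp
  qed
  show "C_const \<alpha> \<beta> = ennreal (if \<alpha> \<le> \<beta> / 2 then 2 powr (1 / \<alpha> - 1 / \<beta>) else 2 powr (1 / \<beta>))"
    if "0 < \<alpha>"
    using pos that assms by simp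
  show "C_const \<alpha> \<beta> = ennreal (if \<alpha> \<le> 2 * \<beta> then 2 powr (1 / \<alpha> - 1 / \<beta>) else 2 powr (- (1 / \<alpha>)))"
    if "\<beta> < 0"
  proof -
    have "- \<beta> \<le> - \<alpha> / 2 \<longleftrightarrow> \<alpha> \<le> 2 * \<beta>" by linarith
    then show ?thesis
      using pos[of "- \<beta>" "- \<alpha>"] C_const_dual[of \<alpha> \<beta>] that assms by simp
  qed
next
  assume *: "\<alpha> < 0 \<and> 0 < \<beta>"
  \<comment> \<open>Here -1/\<alpha> = 1/|\<alpha>|, so the larger exponent belongs to the smaller
    of |\<alpha>| and \<beta>.\<close>
  then have "- (1 / \<alpha>) \<le> 1 / \<beta> \<longleftrightarrow> \<beta> \<le> - \<alpha>" by (simp add: field_simps)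
  then show mixed: "C_const \<alpha> \<beta> = ennreal (if \<beta> \<le> - \<alpha> then 2 powr (1 / \<beta>) else 2 powr (- (1 / \<alpha>)))"
    using C_const_mixed[of \<alpha> \<beta>] * by (auto simp: max_def)
  show "C_const \<alpha> \<beta> = ennreal (2 powr (1 / min \<bar>\<alpha>\<bar> \<beta>))"
    unfolding mixed using * by (simp add: min_def)
qed

end
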